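(* Assume the setting described in the context (with severe limited liability). Then, under both general and binary contracts, the second-best cost converges to the first-best cost exponentially at rate $\mathrm{Ch}(\mu_0,\mu_1)$: $$C^{\mathrm{SB}}_n(\mu,u,c,a^* )-C^{\mathrm{FB}}(u,c,a^* )=\exp[-\mathrm{Ch}(\mu_0,\mu_1)n+o(n)],\qquad C^{\mathrm{bin}}_n(\mu,u,c,a^* )-C^{\mathrm{FB}}(u,c,a^* )=\exp[-\mathrm{Ch}(\mu_0,\mu_1)n+o(n)].$$
   Context: Actions $A=\{0,1\}$, target $a^*=1$. Monitoring technology: Borel probability measures $\mu_0\neq\mu_1$ on a signal space $X$ (subset of a Euclidean space), mutually absolutely continuous, with $\int(\frac{d\mu_{a'}}{d\mu_a})^\lambda d\mu_a<\infty$ for all $\lambda>0$. Under action $a$ the principal observes $n$ i.i.d. draws $x^n$ from $\mu_a$ (expectation $\mathbb{E}_a$). $\underline w\in\mathbb{R}$; $u:[\underline w,\infty)\to\mathbb{R}$ is $C^2$ with $u'>0$, $u''<0$, $\lim_{w\to\infty}u'(w)=0$; $c:A\to\mathbb{R}$ with $c(0)<c(1)$; outside option $0$. Severe limited liability: $u(\underline w)\ge c(0)$, and $u(\underline w)+c(1)-c(0)<\lim_{w\to\infty}u(w)$. Let $h=u^{-1}$. A contract $w:X^n\to[\underline w,\infty)$ satisfies (IC) if $\mathbb{E}_1[u(w)]-c(1)\ge\mathbb{E}_0[u(w)]-c(0)$ and (IR) if $\mathbb{E}_1[u(w)]-c(1)\ge0$. $C^{\mathrm{SB}}_n$ is the infimum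 of $\mathbb{E}_1[w(x^n)]$ over contracts satisfying (IC),(IR); $C^{\mathrm{bin}}_n$ is the same over binary contracts ($|w(X^n)|=2$). The first-best cost is $C^{\mathrm{FB}}(u,c,a^* )=h(u(\underline w)+c(1)-c(0))$. Chernoff distance: $\mathrm{Ch}(\mu_0,\mu_1)=\min_{\nu\in\Delta(X)}\max\{\mathrm{KL}(\nu,\mu_0),\mathrm{KL}(\nu,\mu_1)\}$, where $\mathrm{KL}(\nu,\nu')=\int\log\frac{d\nu}{d\nu'}d\nu$ if $\nu\ll\nu'$, else $\infty$. $f(n)=\exp[-rn+o(n)]$ means $\frac1n\log f(n)\to-r$. *)

theory Defs
  imports "HOL-Probability.Probability"
begin

definition draws :: "nat \<Rightarrow> 'a measure \<Rightarrow> (nat \<Rightarrow> 'a) measure" where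
  "draws n M = PiM {..<n} (\<lambda>_. M)"

definition feasible_contract ::
  "'a measure \<Rightarrow> 'a measure \<Rightarrow> nat \<Rightarrow> (real \<Rightarrow> real) \<Rightarrow> real \<Rightarrow> real \<Rightarrow> real
   \<Rightarrow> ((nat \<Rightarrow> 'a) \<Rightarrow> real) \<Rightarrow> bool" where
  "feasible_contract M0 M1 n u wlow c0 c1 w \<longleftrightarrow>
     w \<in> borel_measurable (draws n M1) \<and>
     (\<forall>x\<in>space (draws n M1). wlow \<le> w x) \<and>
     integrable (draws n M1) w \<and>
     integrable (draws n M1) (\<lambda>x. u (w x)) \<and>
     integrable (draws n M0) (\<lambda>x. u (w x)) \<and>
     (\<integral>x. u (w x) \<partial>draws n M1) - c1 \<ge> (\<integral>x. u (w x) \<partial>draws n M0) - c0 \<and>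
     (\<integral>x. u (w x) \<partial>draws n M1) - c1 \<ge> 0"

definition C_SB ::
  "'a measure \<Rightarrow> 'a measure \<Rightarrow> nat \<Rightarrow> (real \<Rightarrow> real) \<Rightarrow> real \<Rightarrow> real \<Rightarrow> real \<Rightarrow> real" where
  "C_SB M0 M1 n u wlow c0 c1 =
     Inf ((\<lambda>w. \<integral>x. w x \<partial>draws n M1) ` {w. feasible_contract M0 M1 n u wlow c0 c1 w})"

definition C_bin ::
  "'a measure \<Rightarrow> 'a measure \<Rightarrow> nat \<Rightarrow> (real \<Rightarrow> real) \<Rightarrow> real \<Rightarrow> real \<Rightarrow> real \<Rightarrow> real" where
  "C_bin M0 M1 n u wlow c0 c1 =
     Inf ((\<lambda>w. \<integral>x. w x \<partial>draws n M1) `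
          {w. feasible_contract M0 M1 n u wlow c0 c1 w \<and> card (w ` space (draws n M1)) = 2})"

definition C_FB :: "(real \<Rightarrow> real) \<Rightarrow> real \<Rightarrow> real \<Rightarrow> real \<Rightarrow> real" where
  "C_FB u wlow c0 c1 = the_inv_into {wlow..} u (u wlow + c1 - c0)"

definition KL :: "'a measure \<Rightarrow> 'a measure \<Rightarrow> ereal" where
  "KL \<nu> \<nu>' =
    (if absolutely_continuous \<nu>' \<nu> then
       (let f = (\<lambda>x. ln (enn2real (RN_deriv \<nu>' \<nu> x))) in
          enn2ereal (\<integral>\<^sup>+x. ennreal (max 0 (f x)) \<partial>\<nu>)
          - enn2ereal (\<integral>\<^sup>+x. ennreal (max 0 (- f x)) \<partial>\<nu>))
     else \<infinity>)"

definition Chernoff :: "'a measure \<Rightarrow> 'a measure \<Rightarrow> ereal" where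
  "Chernoff M0 M1 =
     Inf {max (KL \<nu> M0) (KL \<nu> M1) | \<nu>. prob_space \<nu> \<and> sets \<nu> = sets M0}"

end

theory Submission
  imports Defs
begin

text \<open>
  Let \<open>B\<close> be the event that the agent is paid above a level strictly between \<open>wlow\<close> and the
  first-best wage. The tangent line of \<open>u\<close> at the first-best wage, whose gap to \<open>u\<close> is bounded
  below off \<open>B\<close>, together with (IC) shows that every feasible contract costs at least a constant
  times the sum of the two error probabilities of the test \<open>B\<close> above first best; the binary contract
  given by the likelihood ratio test attains this order. The minimal error sum is the
  integral of \<open>min 1 (exp T)\<close> under \<open>M0\<close>, where \<open>T\<close> is the log-likelihood ratio of the sample. It is at
  most the \<open>n\<close>-th power of the moment generating function \<open>mgf l\<close> of the log-likelihood ratio under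
  \<open>M0\<close>, and if \<open>mgf\<close> has a critical point at \<open>l\<close>, the nearby moments
  confine \<open>T\<close> to \<open>o(n)\<close> under the tilted measure, giving the matching lower bound. At this \<open>l\<close>, tilting also
  shows that the Chernoff distance is \<open>- ln (mgf l)\<close>.
\<close>

section \<open>Moment generating function of a single log-likelihood ratio\<close>

text \<open>Both signs reduce to \<open>1 + t \<le> exp t\<close>, used at \<open>-y\<close> for
  \<open>y \<ge> 0\<close>. It bounds the difference quotients when \<open>mgf\<close> is
  differentiated.\<close>

lemma abs_exp_minus_one_le: "\<bar>exp (y::real) - 1\<bar> \<le> \<bar>y\<bar> * exp \<bar>y\<bar>"
proof (cases "y \<ge> 0")
  case True
  have "(1 - y) * exp y \<le> exp (- y) * exp y"
    using exp_ge_add_one_self[of "-y"] by (intro mult_right_mono) auto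
  then show ?thesis using True by (simp add: algebra_simps flip: exp_add)
next
  case False
  have "- y * 1 \<le> - y * exp (- y)" using False by (intro mult_left_mono) auto
  moreover have "1 - exp y \<le> - y" using exp_ge_add_one_self[of y] by linarith
  moreover have "exp y < 1" using False by simp
  ultimately have "1 - exp y \<le> - y * exp (- y)" "exp y < 1" by linarith+
  then show ?thesis using False by (simp add: abs_if)
qed

text \<open>Writing the density as \<open>exp (z x)\<close> keeps it positive and finite everywhere.
  Integrability for every real \<open>l\<close> covers the positive moments of both likelihood
  ratios: \<open>l > 0\<close> gives those of dM1/dM0 under \<open>M0\<close>, and
  \<open>l < 1\<close> those of dM0/dM1 under \<open>M1\<close>.\<close>

locale log_likelihood_ratio =
  fixes M0 M1 :: "'a measure" and z :: "'a \<Rightarrow> real"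
  assumes prob0: "prob_space M0" and prob1: "prob_space M1"
    and z_measurable [measurable]: "z \<in> borel_measurable M0"
    and M1_eq_density: "M1 = density M0 (\<lambda>x. ennreal (exp (z x)))"
    and exp_integrable: "\<And>l. integrable M0 (\<lambda>x. exp (l * z x))"
begin

sublocale M0: prob_space M0 by (rule prob0)
sublocale M1: prob_space M1 by (rule prob1)
sublocale PM0: product_prob_space "\<lambda>_::nat. M0" ..
sublocale PM1: product_prob_space "\<lambda>_::nat. M1" ..

definition mgf :: "real \<Rightarrow> real" where
  "mgf l = (\<integral>x. exp (l * z x) \<partial>M0)"

lemma sets_M1 [measurable_cong]: "sets M1 = sets M0"
  by (subst M1_eq_density) simp

lemma abs_times_exp_le: "\<bar>t\<bar> * exp (l * t) \<le> exp ((l + 1) * t) + exp ((l - 1) * t)" for t l :: real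
proof -
  have "\<bar>t\<bar> \<le> exp t + exp (- t)"
    using exp_ge_add_one_self[of t] exp_ge_add_one_self[of "-t"] exp_ge_zero[of t] exp_ge_zero[of "-t"]
    unfolding abs_if by (smt (verit))
  then have "\<bar>t\<bar> * exp (l * t) \<le> (exp t + exp (- t)) * exp (l * t)"
    by (intro mult_right_mono) auto
  then show ?thesis by (simp add: algebra_simps flip: exp_add)
qed

lemma z_exp_integrable: "integrable M0 (\<lambda>x. z x * exp (l * z x))"
  by (rule Bochner_Integration.integrable_bound[where f="\<lambda>x. exp ((l + 1) * z x) + exp ((l - 1) * z x)"])
     (use abs_times_exp_le exp_integrable in \<open>auto simp: abs_mult\<close>)

text \<open>Differentiation under the integral sign, by dominated convergence along null sequences.
  The dominating function is a sum of exponentials with exponents two units away from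
  \<open>l\<close>.\<close>

lemma mgf_has_deriv: "(mgf has_real_derivative (\<integral>x. z x * exp (l * z x) \<partial>M0)) (at l)"
proof -
  \<comment> \<open>Increments of modulus below 1 share one dominating function; the window is a
    neighbourhood of 0, so the limit is unaffected.\<close>
  let ?S = "{-1<..<1::real}"
  have "((\<lambda>h. (mgf (l + h) - mgf l) / h) \<longlongrightarrow> (\<integral>x. z x * exp (l * z x) \<partial>M0)) (at 0 within ?S)"
    unfolding tendsto_at_iff_sequentially comp_def
  proof safe
    fix X :: "nat \<Rightarrow> real"
    assume X: "\<forall>i. X i \<in> ?S - {0}" and X0: "X \<longlonglongrightarrow> 0"
    have lim: "(\<lambda>i. \<integral>x. (exp ((l + X i) * z x) - exp (l * z x)) / X i \<partial>M0)
        \<longlonglongrightarrow> (\<integral>x. z x * exp (l * z x) \<partial>M0)"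
    proof (rule integral_dominated_convergence[where w="\<lambda>x. exp ((l + 2) * z x) + exp ((l - 2) * z x)"])
      show "AE x in M0. (\<lambda>i. (exp ((l + X i) * z x) - exp (l * z x)) / X i)
          \<longlonglongrightarrow> z x * exp (l * z x)"
      proof (rule AE_I2)
        fix x
        have "((\<lambda>l. exp (l * z x)) has_real_derivative z x * exp (l * z x)) (at l)"
          by (auto intro!: derivative_eq_intros)
        then have "((\<lambda>h. (exp ((l + h) * z x) - exp (l * z x)) / h) \<longlongrightarrow> z x * exp (l * z x)) (at 0)"
          by (simp add: DERIV_def)
        moreover have "filterlim X (at 0) sequentially"
          using X X0 by (auto simp: filterlim_at)
        ultimately show "(\<lambda>i. (exp ((l + X i) * z x) - exp (l * z x)) / X i)
            \<longlonglongrightarrow> z x * exp (l * z x)"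
          by (rule filterlim_compose)
      qed
    next
      fix i
      define h where "h = X i"
      have h: "h \<noteq> 0" "\<bar>h\<bar> < 1" using X by (auto simp: h_def abs_less_iff)
      show "AE x in M0. norm ((exp ((l + X i) * z x) - exp (l * z x)) / X i)
              \<le> exp ((l + 2) * z x) + exp ((l - 2) * z x)"
      proof (rule AE_I2)
        fix x
        define t where "t = z x"
        have ht: "\<bar>h * t\<bar> \<le> \<bar>t\<bar>" using h by (simp add: abs_mult mult_left_le_one_le)
        have "\<bar>exp (h * t) - 1\<bar> \<le> \<bar>h * t\<bar> * exp \<bar>h * t\<bar>" by (rule abs_exp_minus_one_le)
        also have "\<dots> \<le> \<bar>h * t\<bar> * exp \<bar>t\<bar>" using ht by (intro mult_left_mono) auto
        also have "\<dots> = \<bar>h\<bar> * (\<bar>t\<bar> * exp \<bar>t\<bar>)" by (simp add: abs_mult)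
        also have "\<bar>t\<bar> * exp \<bar>t\<bar> \<le> exp \<bar>t\<bar> * exp \<bar>t\<bar>"
          using exp_ge_add_one_self[of "\<bar>t\<bar>"] by (intro mult_right_mono) linarith+
        also have "\<dots> \<le> exp (2 * t) + exp (- 2 * t)"
          by (cases "t \<ge> 0") (auto simp flip: exp_add)
        finally have "\<bar>exp (h * t) - 1\<bar> \<le> \<bar>h\<bar> * (exp (2 * t) + exp (- 2 * t))"
          by (simp add: mult_left_mono)
        then have "\<bar>exp (h * t) - 1\<bar> / \<bar>h\<bar> \<le> exp (2 * t) + exp (- 2 * t)"
          using h by (simp add: divide_simps mult.commute)
        then have "\<bar>exp (h * t) - 1\<bar> / \<bar>h\<bar> * exp (l * t) \<le> (exp (2 * t) + exp (- 2 * t)) * exp (l * t)"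
          by (intro mult_right_mono) auto
        also have "\<dots> = exp ((l + 2) * t) + exp ((l - 2) * t)"
          by (simp add: algebra_simps flip: exp_add)
        also have "\<bar>exp (h * t) - 1\<bar> / \<bar>h\<bar> * exp (l * t) = \<bar>(exp ((l + h) * t) - exp (l * t)) / h\<bar>"
        proof -
          have "exp ((l + h) * t) - exp (l * t) = (exp (h * t) - 1) * exp (l * t)"
            by (simp add: algebra_simps flip: exp_add)
          then show ?thesis by (simp add: abs_mult)
        qed
        finally show "norm ((exp ((l + X i) * z x) - exp (l * z x)) / X i)
              \<le> exp ((l + 2) * z x) + exp ((l - 2) * z x)"
          by (simp add: h_def t_def)
      qed
    qed (use exp_integrable in auto)
    show "(\<lambda>i. (mgf (l + X i) - mgf l) / X i) \<longlonglongrightarrow> (\<integral>x. z x * exp (l * z x) \<partial>M0)"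
      using lim exp_integrable by (simp add: mgf_def)
  qed
  then show ?thesis
    by (simp add: DERIV_def at_within_open[of 0 "{-1<..<1}"])
qed

lemma mgf_0: "mgf 0 = 1"
  by (simp add: mgf_def M0.prob_space)

lemma mgf_1: "mgf 1 = 1"
proof -
  have "ennreal (mgf 1) = (\<integral>\<^sup>+x. ennreal (exp (z x)) \<partial>M0)"
    unfolding mgf_def using exp_integrable[of 1] by (simp add: nn_integral_eq_integral)
  also have "\<dots> = emeasure M1 (space M1)"
    by (subst (1 2) M1_eq_density) (simp add: emeasure_density cong: nn_integral_cong)
  finally show ?thesis by (simp add: M1.emeasure_space_1 mgf_def)
qed

lemma mgf_pos: "mgf l > 0"
proof -
  have "mgf l \<ge> 0" unfolding mgf_def by (intro integral_nonneg_AE) auto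
  moreover have "mgf l \<noteq> 0"
  proof
    assume "mgf l = 0"
    then have "AE x in M0. exp (l * z x) = 0"
      unfolding mgf_def using exp_integrable by (subst (asm) integral_nonneg_eq_0_iff_AE) auto
    then have "AE x in M0. False" by simp
    then show False using M0.AE_False by simp
  qed
  ultimately show ?thesis by linarith
qed

text \<open>Expand the nonnegative integral of \<open>(1 - exp (z / 2))\<^sup>2\<close> under \<open>M0\<close>.\<close>

lemma mgf_half_less_one:
  assumes "M0 \<noteq> M1"
  shows "mgf (1/2) < 1"
proof -
  let ?g = "\<lambda>x. (1 - exp (1/2 * z x))\<^sup>2"
  have g_eq: "?g = (\<lambda>x. (exp (0 * z x) - 2 * exp (1/2 * z x)) + exp (1 * z x))"
    by (simp add: fun_eq_iff power2_eq_square algebra_simps flip: exp_add)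
  have g_int: "integrable M0 ?g"
    unfolding g_eq by (intro Bochner_Integration.integrable_add Bochner_Integration.integrable_diff
        integrable_mult_right exp_integrable)
  have "(\<integral>x. ?g x \<partial>M0) = mgf 0 - 2 * mgf (1/2) + mgf 1"
    unfolding g_eq mgf_def using exp_integrable[of 0] exp_integrable[of "1/2"] exp_integrable[of 1]
    by (simp del: integral_const)
  then have eq: "(\<integral>x. ?g x \<partial>M0) = 2 - 2 * mgf (1/2)" by (simp add: mgf_0 mgf_1)
  have "(\<integral>x. ?g x \<partial>M0) \<ge> 0" by simp
  moreover have "(\<integral>x. ?g x \<partial>M0) \<noteq> 0"
  proof
    assume "(\<integral>x. ?g x \<partial>M0) = 0"
    then have "AE x in M0. ?g x = 0"
      using g_int by (subst (asm) integral_nonneg_eq_0_iff_AE) auto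
    then have "AE x in M0. ennreal (exp (z x)) = 1"
      by eventually_elim simp
    then have "density M0 (\<lambda>x. ennreal (exp (z x))) = density M0 (\<lambda>_. 1)"
      by (intro density_cong) auto
    then show False using assms M1_eq_density by (simp add: density_1)
  qed
  ultimately show ?thesis using eq by linarith
qed

text \<open>\<open>mgf\<close> equals 1 at 0 and at 1 and is below 1 at 1/2, so its minimum over the
  unit interval is interior and the derivative vanishes there.\<close>

lemma mgf_min_exists:
  assumes "M0 \<noteq> M1"
  obtains l where "0 < l" "l < 1" "mgf l < 1" "(\<integral>x. z x * exp (l * z x) \<partial>M0) = 0"
proof -
  have cont: "continuous_on {0..1} mgf"
    using mgf_has_deriv by (intro DERIV_atLeastAtMost_imp_continuous_on) auto
  then obtain l where l: "l \<in> {0..1}" and min: "\<And>y. y \<in> {0..1} \<Longrightarrow> mgf l \<le> mgf y"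
    using continuous_attains_inf[of "{0..1}" mgf] by auto
  have lt: "mgf l < 1" using min[of "1/2"] mgf_half_less_one[OF assms] by simp
  have "l \<noteq> 0" "l \<noteq> 1" using lt mgf_0 mgf_1 by auto
  then have l01: "0 < l" "l < 1" using l by auto
  have "(\<integral>x. z x * exp (l * z x) \<partial>M0) = 0"
    by (rule DERIV_local_min[OF mgf_has_deriv, of "min l (1 - l)"]) (use l01 min in \<open>auto simp: abs_less_iff\<close>)
  with l01 lt that show ?thesis by blast
qed

section \<open>Log-likelihood ratio of the sample and the error sums of tests\<close>

definition llr :: "nat \<Rightarrow> (nat \<Rightarrow> 'a) \<Rightarrow> real" where
  "llr n x = (\<Sum>i<n. z (x i))"

lemma llr_measurable [measurable]: "llr n \<in> borel_measurable (draws n M0)"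
  unfolding llr_def draws_def by measurable

lemma sets_draws: "sets (draws n M1) = sets (draws n M0)"
  unfolding draws_def by (intro sets_PiM_cong) (auto simp: sets_M1)

lemma prob_space_draws: "prob_space (draws n M0)" "prob_space (draws n M1)"
  unfolding draws_def by (rule prob_space_PiM, rule prob0, rule prob_space_PiM, rule prob1)

lemma exp_llr_integrable: "integrable (draws n M0) (\<lambda>x. exp (l * llr n x))"
  and integral_exp_llr: "(\<integral>x. exp (l * llr n x) \<partial>draws n M0) = mgf l ^ n"
proof -
  have eq: "(\<lambda>x. exp (l * llr n x)) = (\<lambda>x. \<Prod>i<n. exp (l * z (x i)))"
    by (simp add: llr_def sum_distrib_left exp_sum fun_eq_iff)
  show "integrable (draws n M0) (\<lambda>x. exp (l * llr n x))"
    unfolding eq draws_def by (intro PM0.product_integrable_prod exp_integrable) auto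
  show "(\<integral>x. exp (l * llr n x) \<partial>draws n M0) = mgf l ^ n"
    unfolding eq draws_def by (subst PM0.product_integral_prod) (auto simp: exp_integrable mgf_def)
qed

text \<open>A product measure is determined by its values on measurable boxes, and on a box the
  density and the indicator both factor over the draws.\<close>

lemma draws_density: "draws n M1 = density (draws n M0) (\<lambda>x. ennreal (exp (llr n x)))"
  unfolding draws_def[of n M1]
proof (rule sym, rule PM1.PiM_eqI)
  show "sets (density (draws n M0) (\<lambda>x. ennreal (exp (llr n x)))) = sets (PiM {..<n} (\<lambda>_. M1))"
    using sets_draws by (simp add: draws_def)
next
  fix A :: "nat \<Rightarrow> 'a set" assume A: "\<And>i. i \<in> {..<n} \<Longrightarrow> A i \<in> sets M1"
  have [measurable]: "Pi\<^sub>E {..<n} A \<in> sets (draws n M0)"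
    unfolding draws_def using A by (intro sets_PiM_I_finite) (auto simp: sets_M1)
  have "emeasure (density (draws n M0) (\<lambda>x. ennreal (exp (llr n x)))) (Pi\<^sub>E {..<n} A)
      = (\<integral>\<^sup>+x. ennreal (exp (llr n x)) * indicator (Pi\<^sub>E {..<n} A) x \<partial>draws n M0)"
    by (subst emeasure_density) auto
  also have "\<dots> = (\<integral>\<^sup>+x. (\<Prod>i<n. ennreal (exp (z (x i))) * indicator (A i) (x i)) \<partial>draws n M0)"
  proof (rule nn_integral_cong)
    fix x assume x: "x \<in> space (draws n M0)"
    \<comment> \<open>Points of the product space are extensional, so lying in the box only
      constrains the coordinates below \<open>n\<close>.\<close>
    have "indicator (Pi\<^sub>E {..<n} A) x = (\<Prod>i<n. indicator (A i) (x i) :: ennreal)"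
      using x by (auto simp: draws_def space_PiM indicator_def prod_zero_iff PiE_iff split: if_splits)
    then show "ennreal (exp (llr n x)) * indicator (Pi\<^sub>E {..<n} A) x
        = (\<Prod>i<n. ennreal (exp (z (x i))) * indicator (A i) (x i))"
      by (simp add: llr_def exp_sum prod_ennreal prod.distrib)
  qed
  also have "\<dots> = (\<Prod>i<n. \<integral>\<^sup>+y. ennreal (exp (z y)) * indicator (A i) y \<partial>M0)"
    unfolding draws_def using A
    by (intro PM0.product_nn_integral_prod) (auto simp: sets_M1)
  also have "\<dots> = (\<Prod>i<n. emeasure M1 (A i))"
    using A by (intro prod.cong refl, subst M1_eq_density, subst emeasure_density) (auto simp: sets_M1)
  finally show "emeasure (density (draws n M0) (\<lambda>x. ennreal (exp (llr n x)))) (Pi\<^sub>E {..<n} A)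
     = (\<Prod>i<n. emeasure M1 (A i))" .
qed auto

lemma measure_draws1:
  assumes [measurable]: "B \<in> sets (draws n M0)"
  shows "measure (draws n M1) B = (\<integral>x. exp (llr n x) * indicator B x \<partial>draws n M0)"
proof -
  have "emeasure (draws n M1) B = (\<integral>\<^sup>+x. ennreal (exp (llr n x) * indicator B x) \<partial>draws n M0)"
    by (subst draws_density, subst emeasure_density)
       (auto intro!: nn_integral_cong simp: indicator_def)
  also have "\<dots> = ennreal (\<integral>x. exp (llr n x) * indicator B x \<partial>draws n M0)"
    using exp_llr_integrable[of n 1]
    by (intro nn_integral_eq_integral integrable_real_mult_indicator) auto
  finally show ?thesis by (simp add: measure_def)
qed

text \<open>Twice the Bayes risk under equal priors, or one minus the total variation distance of
  the two sample laws: the integrand is the smaller of their densities relative to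
  \<open>draws n M0\<close>.\<close>

definition bayes :: "nat \<Rightarrow> real" where
  "bayes n = (\<integral>x. min 1 (exp (llr n x)) \<partial>draws n M0)"

lemma min_exp_integrable: "integrable (draws n M0) (\<lambda>x. min 1 (exp (llr n x)))"
  by (rule Bochner_Integration.integrable_bound[OF exp_llr_integrable[of n 1]]) (auto simp: abs_if min_def)

text \<open>The test decides for \<open>M1\<close> on \<open>B\<close>. Moving the second error to
  \<open>draws n M0\<close> merges both errors into one integral, so that tests can be compared
  pointwise.\<close>

lemma error_sum_eq:
  assumes [measurable]: "B \<in> sets (draws n M0)"
  shows "measure (draws n M0) B + measure (draws n M1) (space (draws n M1) - B)
    = (\<integral>x. (if x \<in> B then 1 else exp (llr n x)) \<partial>draws n M0)"
    and "integrable (draws n M0) (\<lambda>x. if x \<in> B then 1 else exp (llr n x))"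
proof -
  interpret D0: prob_space "draws n M0" by (rule prob_space_draws)
  let ?c = "space (draws n M0) - B"
  have sp: "space (draws n M1) = space (draws n M0)" by (rule sets_eq_imp_space_eq[OF sets_draws])
  have i1: "integrable (draws n M0) (\<lambda>x. exp (llr n x) * indicator ?c x)"
    using exp_llr_integrable[of n 1] by (intro integrable_real_mult_indicator) auto
  have i0: "integrable (draws n M0) (\<lambda>x. indicator B x :: real)"
    by (simp add: D0.integrable_const_bound[where B=1])
  have cong: "\<And>x. x \<in> space (draws n M0) \<Longrightarrow>
      (if x \<in> B then 1 else exp (llr n x)) = indicator B x + exp (llr n x) * indicator ?c x"
    by (auto simp: indicator_def)
  show "integrable (draws n M0) (\<lambda>x. if x \<in> B then 1 else exp (llr n x))"
    using Bochner_Integration.integrable_add[OF i0 i1]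
    by (subst Bochner_Integration.integrable_cong[OF refl cong]) auto
  show "measure (draws n M0) B + measure (draws n M1) (space (draws n M1) - B)
    = (\<integral>x. (if x \<in> B then 1 else exp (llr n x)) \<partial>draws n M0)"
    unfolding sp using i0 i1
    by (subst Bochner_Integration.integral_cong[OF refl cong]) (auto simp: measure_draws1 Int_absorb2 sets.sets_into_space)
qed

lemma bayes_le_error_sum:
  assumes "B \<in> sets (draws n M0)"
  shows "bayes n \<le> measure (draws n M0) B + measure (draws n M1) (space (draws n M1) - B)"
  unfolding error_sum_eq(1)[OF assms] bayes_def
  by (intro integral_mono min_exp_integrable error_sum_eq(2)[OF assms]) auto

text \<open>Chernoff's bound. With \<open>T\<close> the value of \<open>llr n\<close>,
  \<open>exp (l * T)\<close> dominates 1 where \<open>T \<ge> 0\<close>, as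
  \<open>l \<ge> 0\<close>, and dominates \<open>exp T\<close> where \<open>T < 0\<close>, as
  \<open>l \<le> 1\<close>.\<close>

lemma error_sum_lr_test:
  fixes n :: nat
  assumes "0 \<le> l" "l \<le> 1"
  defines "B \<equiv> {x \<in> space (draws n M0). llr n x \<ge> 0}"
  shows "measure (draws n M0) B + measure (draws n M1) (space (draws n M1) - B) \<le> mgf l ^ n"
proof -
  have B [measurable]: "B \<in> sets (draws n M0)" unfolding B_def by measurable
  show ?thesis
    unfolding error_sum_eq(1)[OF B] integral_exp_llr[symmetric]
  proof (intro integral_mono exp_llr_integrable error_sum_eq(2)[OF B])
    fix x assume x: "x \<in> space (draws n M0)"
    have "llr n x < 0 \<Longrightarrow> llr n x \<le> l * llr n x"
      using assms(2) mult_right_mono_neg[of l 1 "llr n x"] by simp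
    then show "(if x \<in> B then 1 else exp (llr n x)) \<le> exp (l * llr n x)"
      using x assms(1) by (auto simp: B_def)
  qed
qed

text \<open>The exponential moments at \<open>l + s\<close> and \<open>l - s\<close> control the tails of \<open>llr n\<close>
  under the measure tilted by \<open>exp (l * llr n)\<close>.\<close>

lemma mgf_power_le_bayes:
  fixes d :: real and n :: nat
  assumes "0 \<le> l" "l \<le> 1" "s > 0" "d > 0"
  shows "mgf l ^ n \<le> exp (d * n) * bayes n + exp (- s * d * n) * (mgf (l + s) ^ n + mgf (l - s) ^ n)"
proof -
  let ?r = "\<lambda>x. exp (d * n) * min 1 (exp (llr n x))
     + exp (- s * d * n) * (exp ((l + s) * llr n x) + exp ((l - s) * llr n x))"
  have "mgf l ^ n = (\<integral>x. exp (l * llr n x) \<partial>draws n M0)" by (simp add: integral_exp_llr)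
  also have "\<dots> \<le> (\<integral>x. ?r x \<partial>draws n M0)"
  proof (intro integral_mono exp_llr_integrable Bochner_Integration.integrable_add
        integrable_mult_right min_exp_integrable)
    fix x
    define t where "t = llr n x"
    have nonneg: "exp (d * n) * min 1 (exp t) \<ge> 0" "exp (- s * d * n) * exp ((l + s) * t) \<ge> 0"
      "exp (- s * d * n) * exp ((l - s) * t) \<ge> 0"
      by (auto simp: min_def)
    \<comment> \<open>Each tail is handled by an exponential Markov inequality. In the middle band,
      \<open>exp (l * t)\<close> is at most \<open>exp (d * n)\<close> times both 1 and
      \<open>exp t\<close>, hence times their minimum.\<close>
    consider "t > d * n" | "t < - (d * n)" | "\<bar>t\<bar> \<le> d * n" by linarith
    then have "exp (l * t) \<le> exp (d * n) * min 1 (exp t)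
       + exp (- s * d * n) * (exp ((l + s) * t) + exp ((l - s) * t))"
    proof cases
      case 1
      have "s * (d * n) \<le> s * t" using 1 assms by (intro mult_left_mono) auto
      then have "l * t \<le> - s * d * n + (l + s) * t" by (simp add: algebra_simps)
      then have "exp (l * t) \<le> exp (- s * d * n) * exp ((l + s) * t)"
        by (simp flip: exp_add)
      then show ?thesis unfolding distrib_left using nonneg by linarith
    next
      case 2
      have "s * (d * n) \<le> s * (- t)" using 2 assms by (intro mult_left_mono) auto
      then have "l * t \<le> - s * d * n + (l - s) * t" by (simp add: algebra_simps)
      then have "exp (l * t) \<le> exp (- s * d * n) * exp ((l - s) * t)"
        by (simp flip: exp_add)
      then show ?thesis unfolding distrib_left using nonneg by linarith
    next
      case 3
      have "l * t \<le> d * n"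
        using assms(1,2) 3 mult_left_le_one_le[of "\<bar>t\<bar>" l] mult_left_mono[of t "\<bar>t\<bar>" l]
        by linarith
      moreover have "l * t \<le> d * n + t"
      proof -
        have "(1 - l) * (- t) \<le> (1 - l) * (d * n)" using 3 assms(2) by (intro mult_left_mono) auto
        also have "\<dots> \<le> 1 * (d * n)" using assms by (intro mult_right_mono) auto
        finally have "(1 - l) * (- t) \<le> 1 * (d * n)" .
        then show ?thesis by (simp add: algebra_simps)
      qed
      ultimately have "exp (l * t) \<le> exp (d * n) * min 1 (exp t)"
        unfolding min_def by (simp flip: exp_add)
      then show ?thesis unfolding distrib_left using nonneg by linarith
    qed
    then show "exp (l * llr n x) \<le> ?r x" by (simp add: t_def)
  qed
  also have "\<dots> = exp (d * n) * bayes n + exp (- s * d * n) * (mgf (l + s) ^ n + mgf (l - s) ^ n)"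
    using exp_llr_integrable min_exp_integrable by (simp add: bayes_def integral_exp_llr)
  finally show ?thesis .
qed

text \<open>At a critical point, \<open>mgf (l + s)\<close> and \<open>mgf (l - s)\<close> differ
  from \<open>mgf l\<close> by o(s), so for small \<open>s\<close> the factor
  \<open>exp (- d * s)\<close> pushes both strictly below \<open>mgf l\<close>. The tail terms of
  \<open>mgf_power_le_bayes\<close> are then geometrically smaller than
  \<open>mgf l ^ n\<close>.\<close>

lemma bayes_lower_bound:
  fixes d :: real
  assumes l: "0 \<le> l" "l \<le> 1" and deriv0: "(\<integral>x. z x * exp (l * z x) \<partial>M0) = 0" and d: "d > 0"
  shows "eventually (\<lambda>n. bayes n \<ge> exp (- d * n) * mgf l ^ n / 2) sequentially"
proof -
  \<comment> \<open>Used with \<open>c = 1\<close> and \<open>c = -1\<close>, one for each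
    tail.\<close>
  have ev: "eventually (\<lambda>s. mgf (l + c * s) * exp (- d * s) < mgf l) (at_right 0)" for c :: real
  proof -
    have "((\<lambda>s. mgf (l + c * s) * exp (- d * s)) has_real_derivative - (d * mgf l)) (at 0)"
    proof -
      have "(mgf has_real_derivative 0) (at (l + c * 0))" using mgf_has_deriv[of l] deriv0 by simp
      then have "((\<lambda>s. mgf (l + c * s)) has_real_derivative 0 * c) (at 0)"
        by (rule DERIV_chain2) (auto intro!: derivative_eq_intros)
      then show ?thesis by (auto intro!: derivative_eq_intros)
    qed
    moreover have "- (d * mgf l) < 0" using d mgf_pos[of l] by simp
    ultimately obtain e where "e > 0" and
      "\<forall>h>0. h < e \<longrightarrow> mgf (l + c * (0 + h)) * exp (- d * (0 + h)) < mgf (l + c * 0) * exp (- d * 0)"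
      by (blast dest: DERIV_neg_dec_right)
    then show ?thesis
      unfolding eventually_at_right_field by (auto intro!: exI[of _ e])
  qed
  have "eventually (\<lambda>s. s > 0 \<and> mgf (l + 1 * s) * exp (- d * s) < mgf l
      \<and> mgf (l + (-1) * s) * exp (- d * s) < mgf l) (at_right 0)"
    by (intro eventually_conj ev eventually_at_right_less)
  from eventually_happens'[OF trivial_limit_at_right_real this]
  obtain s where s: "s > 0" "mgf (l + s) * exp (- d * s) < mgf l" "mgf (l - s) * exp (- d * s) < mgf l"
    by auto
  \<comment> \<open>The ratio, per draw, of the larger tail term to \<open>mgf l\<close>.\<close>
  define q where "q = max (mgf (l + s)) (mgf (l - s)) * exp (- d * s) / mgf l"
  have q: "0 \<le> q" "q < 1"
    using s mgf_pos[of l] mgf_pos[of "l+s"] by (auto simp: q_def max_def)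
  have q1: "mgf (l + s) * exp (- d * s) \<le> q * mgf l" "mgf (l - s) * exp (- d * s) \<le> q * mgf l"
    using mgf_pos[of l] by (auto simp: q_def)
  have "(\<lambda>n. q ^ n) \<longlonglongrightarrow> 0" using q by (intro LIMSEQ_realpow_zero) auto
  \<comment> \<open>With 1/4 for each tail, the two together consume at most half of
    \<open>mgf l ^ n\<close>.\<close>
  then have "eventually (\<lambda>n. q ^ n < 1/4) sequentially"
    by (rule order_tendstoD) simp
  then show ?thesis
  proof eventually_elim
    case (elim n)
    have pow: "exp (- s * d * n) * m ^ n \<le> q ^ n * mgf l ^ n"
      if "m * exp (- d * s) \<le> q * mgf l" "m > 0" for m
    proof -
      have "exp (- s * d * n) * m ^ n = (m * exp (- d * s)) ^ n"
        by (simp add: power_mult_distrib exp_of_nat_mult[symmetric] mult_ac)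
      also have "\<dots> \<le> (q * mgf l) ^ n" using that by (intro power_mono) auto
      finally show ?thesis by (simp add: power_mult_distrib)
    qed
    have "mgf l ^ n \<le> exp (d * n) * bayes n + exp (- s * d * n) * (mgf (l + s) ^ n + mgf (l - s) ^ n)"
      by (rule mgf_power_le_bayes[OF l s(1) d])
    also have "\<dots> \<le> exp (d * n) * bayes n + 2 * (q ^ n * mgf l ^ n)"
      using pow[OF q1(1) mgf_pos] pow[OF q1(2) mgf_pos] by (simp add: distrib_left)
    also have "\<dots> \<le> exp (d * n) * bayes n + 2 * (1/4 * mgf l ^ n)"
      using elim mgf_pos[of l] by (intro add_mono mult_left_mono mult_right_mono) auto
    finally have "mgf l ^ n / 2 \<le> exp (d * n) * bayes n" by simp
    then have "exp (- d * n) * (mgf l ^ n / 2) \<le> exp (- d * n) * (exp (d * n) * bayes n)"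
      by (intro mult_left_mono) auto
    then show ?case by (simp add: mult.assoc[symmetric] flip: exp_add)
  qed
qed

end

section \<open>Kullback-Leibler divergence and the Chernoff distance\<close>

text \<open>A finite negative part excludes \<open>\<infinity> - \<infinity>\<close>, and
  integrability can then fail only through an infinite positive part.\<close>

lemma enn2ereal_integral_diff:
  fixes f :: "'a \<Rightarrow> real"
  assumes [measurable]: "f \<in> borel_measurable N" and neg: "(\<integral>\<^sup>+x. ennreal (- f x) \<partial>N) < \<infinity>"
  shows "enn2ereal (\<integral>\<^sup>+x. ennreal (max 0 (f x)) \<partial>N) - enn2ereal (\<integral>\<^sup>+x. ennreal (max 0 (- f x)) \<partial>N)
    = (if integrable N f then ereal (\<integral>x. f x \<partial>N) else \<infinity>)"
proof -
  let ?p = "\<integral>\<^sup>+x. ennreal (f x) \<partial>N" and ?m = "\<integral>\<^sup>+x. ennreal (- f x) \<partial>N"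
  have eq: "ennreal (max 0 t) = ennreal t" for t :: real
    by (cases "t \<ge> 0") (auto simp: ennreal_neg)
  have fin: "enn2ereal a = ereal (enn2real a)" if "a < \<infinity>" for a
    using that by (cases a) auto
  show ?thesis
  proof (cases "?p < \<infinity>")
    case True
    then have "integrable N f" using neg by (subst real_integrable_def) (auto simp: less_top)
    then show ?thesis using True neg by (simp add: eq fin real_lebesgue_integral_def)
  next
    case False
    then have "\<not> integrable N f" and "?p = \<infinity>"
      by (auto simp: real_integrable_def less_top[symmetric])
    then show ?thesis using neg by (simp add: eq fin)
  qed
qed

lemma KL_density_exp:
  assumes "sigma_finite_measure M" and g [measurable]: "g \<in> borel_measurable M"
    and N: "N = density M (\<lambda>x. ennreal (exp (g x)))" and int: "integrable N g"
  shows "KL N M = ereal (\<integral>x. g x \<partial>N)"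
proof -
  interpret sigma_finite_measure M by fact
  have ac: "absolutely_continuous M N"
    unfolding N by (rule absolutely_continuousI_density) measurable
  have "AE x in M. ennreal (exp (g x)) = RN_deriv M N x"
    by (rule RN_deriv_unique) (auto simp: N)
  then have ae: "AE x in N. ln (enn2real (RN_deriv M N x)) = g x"
    unfolding N by (subst AE_density) (auto elim!: eventually_mono dest: sym)
  have "KL N M = enn2ereal (\<integral>\<^sup>+x. ennreal (max 0 (g x)) \<partial>N) - enn2ereal (\<integral>\<^sup>+x. ennreal (max 0 (- g x)) \<partial>N)"
    unfolding KL_def Let_def using ac ae
    by (auto intro!: arg_cong2[where f="(-)"] arg_cong[where f=enn2ereal] nn_integral_cong_AE)
  also have "\<dots> = ereal (\<integral>x. g x \<partial>N)"
  proof (subst enn2ereal_integral_diff)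
    show "(\<integral>\<^sup>+x. ennreal (- g x) \<partial>N) < \<infinity>"
      using int by (auto simp: real_integrable_def less_top)
  qed (use int in auto)
  finally show ?thesis .
qed

text \<open>The negative part of the log density is always integrable: moved to \<open>M\<close>,
  its integrand becomes the positive part of \<open>- r * ln r\<close>, which is at most 1, and
  \<open>M\<close> has mass 1.\<close>

lemma KL_cases:
  assumes "prob_space M" "prob_space N" and ac: "absolutely_continuous M N" and sets: "sets N = sets M"
  shows "KL N M = \<infinity> \<or> (integrable N (\<lambda>x. ln (enn2real (RN_deriv M N x)))
     \<and> KL N M = ereal (\<integral>x. ln (enn2real (RN_deriv M N x)) \<partial>N))"
proof -
  interpret prob_space M by fact
  interpret N: prob_space N by fact
  let ?f = "\<lambda>x. ln (enn2real (RN_deriv M N x))"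
  have [measurable_cong]: "sets N = sets M" by fact
  have fin: "AE x in M. RN_deriv M N x \<noteq> \<infinity>"
    by (rule RN_deriv_finite) (auto simp: N.sigma_finite_measure_axioms ac sets)
  have "(\<integral>\<^sup>+x. ennreal (- ?f x) \<partial>N) = (\<integral>\<^sup>+x. RN_deriv M N x * ennreal (- ?f x) \<partial>M)"
    by (rule RN_deriv_nn_integral[OF ac sets]) measurable
  also have "\<dots> \<le> (\<integral>\<^sup>+x. 1 \<partial>M)"
  proof (rule nn_integral_mono_AE, use fin in eventually_elim)
    case (elim x)
    then obtain r where r: "RN_deriv M N x = ennreal r" "r \<ge> 0" by (cases "RN_deriv M N x") auto
    have "r * (- ln r) \<le> 1"
    proof (cases "r = 0")
      case False
      then have "- ln r \<le> 1 / r - 1" using ln_le_minus_one[of "1/r"] r by (simp add: ln_div)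
      then have "r * (- ln r) \<le> r * (1 / r - 1)" using r by (intro mult_left_mono) auto
      then show ?thesis using r False by (simp add: algebra_simps)
    qed simp
    then show ?case using r by (simp flip: ennreal_mult' ennreal_1 add: ennreal_leI)
  qed
  also have "\<dots> < \<infinity>" by (simp add: emeasure_space_1)
  finally have "(\<integral>\<^sup>+x. ennreal (- ?f x) \<partial>N) < \<infinity>" .
  then show ?thesis
    unfolding KL_def Let_def using ac by (subst (1 2) enn2ereal_integral_diff) auto
qed

context log_likelihood_ratio
begin

lemma M0_eq_density: "M0 = density M1 (\<lambda>x. ennreal (exp (- z x)))"
proof -
  have "density M1 (\<lambda>x. ennreal (exp (- z x))) = density M0 (\<lambda>x. ennreal (exp (z x)) * ennreal (exp (- z x)))"
    by (subst M1_eq_density, rule density_density_eq) measurable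
  also have "\<dots> = density M0 (\<lambda>_. 1)"
    by (intro density_cong AE_I2) (simp_all flip: ennreal_mult' exp_add)
  finally show ?thesis by (simp add: density_1)
qed

text \<open>The tilted measure with density \<open>exp (l * z) / mgf l\<close> is equidistant from \<open>M0\<close> and \<open>M1\<close>.\<close>

lemma Chernoff_le:
  assumes deriv0: "(\<integral>x. z x * exp (l * z x) \<partial>M0) = 0"
  shows "Chernoff M0 M1 \<le> ereal (- ln (mgf l))"
proof -
  define g where "g = (\<lambda>x. l * z x - ln (mgf l))"
  define N where "N = density M0 (\<lambda>x. ennreal (exp (g x)))"
  have [measurable]: "g \<in> borel_measurable M0" unfolding g_def by measurable
  have exp_g: "exp (g x) = exp (l * z x) / mgf l" for x
    using mgf_pos[of l] by (simp add: g_def exp_diff)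
  have setsN [measurable_cong]: "sets N = sets M0" by (simp add: N_def)
  have "emeasure N (space N) = (\<integral>\<^sup>+x. ennreal (exp (g x)) \<partial>M0)"
    by (simp add: N_def emeasure_density cong: nn_integral_cong)
  also have "\<dots> = ennreal (\<integral>x. exp (g x) \<partial>M0)"
    using exp_integrable by (intro nn_integral_eq_integral) (auto simp: exp_g less_imp_le[OF mgf_pos])
  also have "\<dots> = 1" using mgf_pos[of l] by (simp add: exp_g mgf_def)
  finally have probN: "prob_space N" by (rule prob_spaceI)
  then interpret N: prob_space N .
  have zN: "integrable N z" unfolding N_def using z_exp_integrable[of l]
    by (subst integrable_density) (auto simp: exp_g mult.commute less_imp_le[OF mgf_pos])
  \<comment> \<open>The critical point makes \<open>z\<close> centred under \<open>N\<close>. Hence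
    the log densities \<open>g\<close> and \<open>g - z\<close> of \<open>N\<close>, relative to
    \<open>M0\<close> and \<open>M1\<close>, have the same mean.\<close>
  have zN0: "(\<integral>x. z x \<partial>N) = 0" unfolding N_def using deriv0
    by (subst integral_density) (auto simp: exp_g mult.commute less_imp_le[OF mgf_pos])
  have gN: "integrable N g" using zN by (simp add: g_def)
  have "KL N M0 = ereal (\<integral>x. g x \<partial>N)"
    by (rule KL_density_exp[OF M0.sigma_finite_measure_axioms _ N_def gN]) measurable
  also have "(\<integral>x. g x \<partial>N) = - ln (mgf l)" using zN zN0 by (simp add: g_def N.prob_space)
  finally have KL0: "KL N M0 = ereal (- ln (mgf l))" .
  have "KL N M1 = ereal (\<integral>x. g x - z x \<partial>N)"
  proof (rule KL_density_exp)
    have "N = density (density M1 (\<lambda>x. ennreal (exp (- z x)))) (\<lambda>x. ennreal (exp (g x)))"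
      unfolding N_def by (subst M0_eq_density) (rule refl)
    also have "\<dots> = density M1 (\<lambda>x. ennreal (exp (- z x)) * ennreal (exp (g x)))"
      by (rule density_density_eq) measurable
    also have "\<dots> = density M1 (\<lambda>x. ennreal (exp (g x - z x)))"
      by (intro density_cong AE_I2) (simp_all flip: ennreal_mult' exp_add)
    finally show "N = density M1 (\<lambda>x. ennreal (exp (g x - z x)))" .
  qed (use zN gN in \<open>auto simp: M1.sigma_finite_measure_axioms\<close>)
  also have "(\<integral>x. g x - z x \<partial>N) = - ln (mgf l)" using zN zN0 by (simp add: g_def N.prob_space)
  finally have "max (KL N M0) (KL N M1) = ereal (- ln (mgf l))" using KL0 by simp
  then show ?thesis unfolding Chernoff_def using probN setsN by (intro Inf_lower) force
qed

text \<open>Jensen's inequality for the convex combination \<open>(1 - l) * KL N M0 + l * KL N M1\<close>,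
  proved through \<open>ln t \<le> t - 1\<close>.\<close>

lemma Chernoff_ge:
  assumes l: "0 \<le> l" "l \<le> 1"
  shows "ereal (- ln (mgf l)) \<le> Chernoff M0 M1"
  unfolding Chernoff_def
proof (rule Inf_greatest, safe)
  fix N :: "'a measure" assume N: "prob_space N" and sets: "sets N = sets M0"
  interpret N: prob_space N by fact
  have [measurable_cong]: "sets N = sets M0" by fact
  show "ereal (- ln (mgf l)) \<le> max (KL N M0) (KL N M1)"
  proof (cases "KL N M0 = \<infinity> \<or> KL N M1 = \<infinity>")
    case False
    then have ac: "absolutely_continuous M0 N" "absolutely_continuous M1 N"
      by (auto simp: KL_def split: if_splits)
    define g0 where "g0 = (\<lambda>x. ln (enn2real (RN_deriv M0 N x)))"
    define g1 where "g1 = (\<lambda>x. ln (enn2real (RN_deriv M1 N x)))"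
    have g0: "integrable N g0" "KL N M0 = ereal (\<integral>x. g0 x \<partial>N)"
      using KL_cases[OF prob0 N ac(1) sets] False by (auto simp: g0_def)
    have g1: "integrable N g1" "KL N M1 = ereal (\<integral>x. g1 x \<partial>N)"
      using KL_cases[OF prob1 N ac(2)] False sets sets_M1 by (auto simp: g1_def)
    have dens: "density M0 (RN_deriv M0 N) = N"
      by (rule M0.density_RN_deriv[OF ac(1) sets])
    have "density M0 (\<lambda>x. ennreal (exp (z x)) * RN_deriv M1 N x) = density M1 (RN_deriv M1 N)"
      by (subst (2) M1_eq_density, rule density_density_eq[symmetric]) measurable
    also have "\<dots> = N" by (rule M1.density_RN_deriv[OF ac(2)]) (simp add: sets sets_M1)
    finally have "AE x in M0. ennreal (exp (z x)) * RN_deriv M1 N x = RN_deriv M0 N x"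
      by (intro M0.RN_deriv_unique) auto
    then have "AE x in N. ennreal (exp (z x)) * RN_deriv M1 N x = RN_deriv M0 N x"
      by (rule absolutely_continuous_AE[OF sets ac(1)])
    moreover have fin: "AE x in M0. RN_deriv M0 N x \<noteq> \<infinity>"
      by (rule M0.RN_deriv_finite) (auto simp: N.sigma_finite_measure_axioms ac sets)
    then have "AE x in N. RN_deriv M0 N x \<noteq> \<infinity>"
      by (rule absolutely_continuous_AE[OF sets ac(1)])
    moreover have "AE x in N. RN_deriv M0 N x > 0"
      by (subst dens[symmetric], subst AE_density) auto
    \<comment> \<open>The chain rule for Radon-Nikodym derivatives in logarithmic form; positivity
      and finiteness keep \<open>ln\<close> and \<open>enn2real\<close> away from their default
      values.\<close>
    ultimately have g01: "AE x in N. g0 x = z x + g1 x"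
    proof eventually_elim
      case (elim x)
      then obtain r where r: "RN_deriv M0 N x = ennreal r" "r > 0"
        by (cases "RN_deriv M0 N x") (auto simp: ennreal_eq_0_iff)
      have ne: "RN_deriv M1 N x \<noteq> \<infinity>" "RN_deriv M1 N x \<noteq> 0"
        using elim by (auto simp: ennreal_mult_eq_top_iff)
      then obtain t where t: "RN_deriv M1 N x = ennreal t" "t > 0"
        by (cases "RN_deriv M1 N x") (auto simp: ennreal_eq_0_iff less_le)
      have "exp (z x) * t = r" using elim(1) r t by (simp flip: ennreal_mult' add: ennreal_inj)
      then show ?case using r t by (auto simp: g0_def g1_def ln_mult)
    qed
    have [measurable]: "g0 \<in> borel_measurable N" "g1 \<in> borel_measurable N"
      using g0 g1 by auto
    \<comment> \<open>Only an inequality holds in general, because \<open>M0\<close> may charge the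
      set where the density of \<open>N\<close> vanishes.\<close>
    have nn: "(\<integral>\<^sup>+x. ennreal (exp (l * z x - g0 x)) \<partial>N) \<le> ennreal (mgf l)"
    proof -
      have "(\<integral>\<^sup>+x. ennreal (exp (l * z x - g0 x)) \<partial>N)
          = (\<integral>\<^sup>+x. RN_deriv M0 N x * ennreal (exp (l * z x - g0 x)) \<partial>M0)"
        by (rule M0.RN_deriv_nn_integral[OF ac(1) sets]) (unfold g0_def, measurable)
      also have "\<dots> \<le> (\<integral>\<^sup>+x. ennreal (exp (l * z x)) \<partial>M0)"
      proof (rule nn_integral_mono_AE, use fin in eventually_elim)
        case (elim x)
        then obtain r where r: "RN_deriv M0 N x = ennreal r" "r \<ge> 0" by (cases "RN_deriv M0 N x") auto
        show ?case
        proof (cases "r = 0")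
          case False
          then have "r * exp (l * z x - g0 x) = exp (l * z x)"
            using r by (simp add: g0_def exp_diff)
          then show ?thesis using r by (simp flip: ennreal_mult')
        qed (use r in simp)
      qed
      also have "\<dots> = ennreal (mgf l)"
        unfolding mgf_def using exp_integrable by (intro nn_integral_eq_integral) auto
      finally show ?thesis .
    qed
    have int_e: "integrable N (\<lambda>x. exp (l * z x - g0 x))"
      using nn by (intro integrableI_bounded) (auto simp: less_top[symmetric] top_unique)
    have "(\<integral>\<^sup>+x. ennreal (exp (l * z x - g0 x)) \<partial>N) = ennreal (\<integral>x. exp (l * z x - g0 x) \<partial>N)"
      using int_e by (intro nn_integral_eq_integral) auto
    from nn[unfolded this] have e_le: "(\<integral>x. exp (l * z x - g0 x) \<partial>N) \<le> mgf l"
      using mgf_pos[of l] by (simp add: ennreal_le_iff)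
    \<comment> \<open>Here \<open>ln t \<le> t - 1\<close> is taken at
      \<open>t = exp (l * z x - g0 x) / mgf l\<close>, whose mean under \<open>N\<close> is at most
      1.\<close>
    have "(\<integral>x. - ((1 - l) * g0 x + l * g1 x) \<partial>N) \<le> (\<integral>x. exp (l * z x - g0 x) / mgf l - 1 + ln (mgf l) \<partial>N)"
    proof (rule integral_mono_AE)
      show "AE x in N. - ((1 - l) * g0 x + l * g1 x) \<le> exp (l * z x - g0 x) / mgf l - 1 + ln (mgf l)"
        using g01
      proof eventually_elim
        case (elim x)
        have "ln (exp (l * z x - g0 x) / mgf l) \<le> exp (l * z x - g0 x) / mgf l - 1"
          using mgf_pos[of l] by (intro ln_le_minus_one) auto
        then have "l * z x - g0 x - ln (mgf l) \<le> exp (l * z x - g0 x) / mgf l - 1"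
          using mgf_pos[of l] by (simp add: ln_div)
        moreover have "- ((1 - l) * g0 x + l * g1 x) = l * z x - g0 x"
          using elim by (simp add: algebra_simps)
        ultimately show ?case by simp
      qed
    qed (use g0 g1 int_e in auto)
    also have "\<dots> = (\<integral>x. exp (l * z x - g0 x) \<partial>N) / mgf l - 1 + ln (mgf l)"
      using int_e by (simp add: N.prob_space)
    also have "\<dots> \<le> ln (mgf l)" using e_le mgf_pos[of l] by simp
    also have "(\<integral>x. - ((1 - l) * g0 x + l * g1 x) \<partial>N) = - ((1 - l) * (\<integral>x. g0 x \<partial>N) + l * (\<integral>x. g1 x \<partial>N))"
      using g0 g1 by simp
    finally have "- ln (mgf l) \<le> (1 - l) * (\<integral>x. g0 x \<partial>N) + l * (\<integral>x. g1 x \<partial>N)" by simp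
    also have "\<dots> \<le> max (\<integral>x. g0 x \<partial>N) (\<integral>x. g1 x \<partial>N)"
      using l by (intro convex_bound_le) auto
    finally show ?thesis using g0 g1 by (simp add: max_def split: if_splits)
  qed auto
qed

end

section \<open>From Radon-Nikodym derivatives to a real log-likelihood ratio\<close>

lemma log_likelihood_ratioI:
  assumes P0: "prob_space M0" and P1: "prob_space M1"
    and sets: "sets M1 = sets M0"
    and ac01: "absolutely_continuous M0 M1" and ac10: "absolutely_continuous M1 M0"
    and mom01: "\<And>l::real. l > 0 \<Longrightarrow> integrable M0 (\<lambda>x. enn2real (RN_deriv M0 M1 x) powr l)"
    and mom10: "\<And>l::real. l > 0 \<Longrightarrow> integrable M1 (\<lambda>x. enn2real (RN_deriv M1 M0 x) powr l)"
  shows "log_likelihood_ratio M0 M1 (\<lambda>x. ln (enn2real (RN_deriv M0 M1 x)))"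
proof -
  interpret M0: prob_space M0 by fact
  interpret M1: prob_space M1 by fact
  define z where "z = (\<lambda>x. ln (enn2real (RN_deriv M0 M1 x)))"
  have [measurable_cong]: "sets M1 = sets M0" by fact
  have z_meas [measurable]: "z \<in> borel_measurable M0" unfolding z_def by measurable
  have dens: "density M0 (RN_deriv M0 M1) = M1"
    by (rule M0.density_RN_deriv[OF ac01 sets])
  \<comment> \<open>Positivity is automatic \<open>M1\<close>-almost everywhere and passes to
    \<open>M0\<close> by absolute continuity. Default values of \<open>ln\<close> and
    \<open>enn2real\<close> thus matter only on a null set.\<close>
  have "AE x in M1. RN_deriv M0 M1 x > 0"
    by (subst dens[symmetric], subst AE_density) auto
  then have "AE x in M0. RN_deriv M0 M1 x > 0"
    by (rule absolutely_continuous_AE[OF sets[symmetric] ac10])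
  moreover have "AE x in M0. RN_deriv M0 M1 x \<noteq> \<infinity>"
    by (rule M0.RN_deriv_finite) (auto simp: M1.sigma_finite_measure_axioms ac01 sets)
  ultimately have ae: "AE x in M0. RN_deriv M0 M1 x = ennreal (exp (z x)) \<and> enn2real (RN_deriv M0 M1 x) = exp (z x)"
  proof eventually_elim
    case (elim x)
    then obtain r where r: "RN_deriv M0 M1 x = ennreal r" "r > 0"
      by (cases "RN_deriv M0 M1 x") (auto simp: ennreal_eq_0_iff)
    then show ?case by (simp add: z_def)
  qed
  have M1: "M1 = density M0 (\<lambda>x. ennreal (exp (z x)))"
    by (subst dens[symmetric], rule density_cong) (use ae in \<open>auto elim: eventually_mono\<close>)
  have "density M1 (\<lambda>x. ennreal (exp (- z x))) = density M0 (\<lambda>x. ennreal (exp (z x)) * ennreal (exp (- z x)))"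
    by (subst M1, rule density_density_eq) measurable
  also have "\<dots> = density M0 (\<lambda>_. 1)"
    by (intro density_cong AE_I2) (simp_all flip: ennreal_mult' exp_add)
  finally have "AE x in M1. ennreal (exp (- z x)) = RN_deriv M1 M0 x"
    by (intro M1.RN_deriv_unique) (auto simp: density_1)
  then have ae1: "AE x in M1. enn2real (RN_deriv M1 M0 x) = exp (- z x)"
    by eventually_elim (metis enn2real_ennreal exp_ge_zero)
  have pos: "integrable M0 (\<lambda>x. exp (l * z x))" if "l > 0" for l
  proof (subst integrable_cong_AE)
    show "AE x in M0. exp (l * z x) = enn2real (RN_deriv M0 M1 x) powr l"
      using ae by eventually_elim (simp add: powr_def)
  qed (use mom01[OF that] in auto)
  \<comment> \<open>Changing measure turns the moment \<open>l\<close> under \<open>M0\<close> into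
    the moment \<open>l - 1\<close> under \<open>M1\<close>, a positive power of dM0/dM1. Together
    with \<open>pos\<close> this covers the whole line.\<close>
  have neg: "integrable M0 (\<lambda>x. exp (l * z x))" if "l < 1" for l
  proof -
    have "integrable M1 (\<lambda>x. exp ((l - 1) * z x))"
    proof (subst integrable_cong_AE)
      show "AE x in M1. exp ((l - 1) * z x) = enn2real (RN_deriv M1 M0 x) powr (1 - l)"
        using ae1 by eventually_elim (simp add: powr_def algebra_simps)
    qed (use mom10[of "1 - l"] that in auto)
    then show ?thesis
      by (subst (asm) M1, subst (asm) integrable_density) (auto simp: algebra_simps simp flip: exp_add)
  qed
  have int: "integrable M0 (\<lambda>x. exp (l * z x))" for l
    using pos[of l] neg[of l] by (cases "l > 0") auto
  show ?thesis
    unfolding z_def[symmetric] by (rule log_likelihood_ratio.intro[OF P0 P1 z_meas M1 int])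
qed

section \<open>Concave utility and bounds on the cost of contracts\<close>

text \<open>Derivatives within the half-line are one-sided at \<open>wlow\<close>, so the mean value
  theorem is put in a form that admits \<open>wlow\<close> as left end point.\<close>

lemma mvt_atLeast:
  fixes f f' :: "real \<Rightarrow> real"
  assumes deriv: "\<And>w. wlow \<le> w \<Longrightarrow> (f has_real_derivative f' w) (at w within {wlow..})"
    and "wlow \<le> a" "a < b"
  obtains \<xi> where "a < \<xi>" "\<xi> < b" "f b - f a = f' \<xi> * (b - a)"
proof -
  have "\<exists>x\<in>{a<..<b}. f b - f a = f' x * (b - a)"
  proof (rule mvt_simple)
    fix x assume "a \<le> x" "x \<le> b"
    then have "(f has_real_derivative f' x) (at x within {a..b})"
      using assms by (intro DERIV_subset[OF deriv]) auto
    then show "(f has_derivative (*) (f' x)) (at x within {a..b})"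
      by (simp add: has_field_derivative_def)
  qed fact
  with that show ?thesis by auto
qed

text \<open>By strict concavity the gap between the tangent at \<open>ws\<close> and
  \<open>u\<close> decreases to the left of \<open>ws\<close>, so its value \<open>r\<close> at
  \<open>a\<close> bounds it from below on all of \<open>w \<le> a\<close>.\<close>

lemma tangent_gap:
  fixes u u' :: "real \<Rightarrow> real"
  assumes deriv: "\<And>w. wlow \<le> w \<Longrightarrow> (u has_real_derivative u' w) (at w within {wlow..})"
    and decr: "\<And>v w. wlow \<le> v \<Longrightarrow> v < w \<Longrightarrow> u' w < u' v"
    and a: "wlow \<le> a" "a < ws"
  obtains r where "r > 0"
    "\<And>w. wlow \<le> w \<Longrightarrow> u w - u ws + (if w \<le> a then r else 0) \<le> u' ws * (w - ws)"
proof -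
  define r where "r = u ws + u' ws * (a - ws) - u a"
  have left: "u y - u x > u' ws * (y - x)" if xy: "wlow \<le> x" "x < y" "y \<le> ws" for x y
  proof -
    obtain \<xi> where "x < \<xi>" "\<xi> < y" "u y - u x = u' \<xi> * (y - x)"
      using mvt_atLeast[OF deriv xy(1,2)] by blast
    moreover have "u' ws < u' \<xi>" using \<open>\<xi> < y\<close> \<open>x < \<xi>\<close> xy by (intro decr) auto
    ultimately show ?thesis using xy by simp
  qed
  have right: "u w - u ws \<le> u' ws * (w - ws)" if w: "ws < w" for w
  proof -
    obtain \<xi> where "ws < \<xi>" "\<xi> < w" "u w - u ws = u' \<xi> * (w - ws)"
      using mvt_atLeast[OF deriv order_trans[OF a(1) less_imp_le[OF a(2)]] w] by blast
    moreover have "u' \<xi> < u' ws" using \<open>ws < \<xi>\<close> a by (intro decr) auto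
    ultimately show ?thesis using w by simp
  qed
  have "r > 0" using left[of a ws] a by (simp add: r_def algebra_simps)
  moreover have "u w - u ws + (if w \<le> a then r else 0) \<le> u' ws * (w - ws)" if "wlow \<le> w" for w
  proof -
    consider "w < a" | "w = a" | "a < w" "w < ws" | "w = ws" | "ws < w" by linarith
    then show ?thesis
    proof cases
      case 1
      then show ?thesis using left[of w a] that a by (simp add: r_def algebra_simps)
    next
      case 3
      then show ?thesis using left[of w ws] that a by (simp add: algebra_simps)
    qed (use a right in \<open>auto simp: r_def\<close>)
  qed
  ultimately show ?thesis using that by blast
qed

context log_likelihood_ratio
begin

text \<open>Read \<open>w\<close> as a test deciding for \<open>M1\<close> where it pays more than
  \<open>a\<close>. Payments above \<open>a\<close> under \<open>M0\<close> lift expected utility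
  above \<open>u wlow\<close>; (IC) carries the lift over to \<open>M1\<close>, above
  \<open>u ws\<close>; \<open>gap\<close> turns it into wage and adds \<open>r\<close> where the
  test errs under \<open>M1\<close>.\<close>

lemma contract_cost_ge:
  assumes feas: "feasible_contract M0 M1 n u wlow c0 c1 w"
    and mono: "\<And>v w. wlow \<le> v \<Longrightarrow> v \<le> w \<Longrightarrow> u v \<le> u w"
    and a: "wlow \<le> a" and ws: "u ws = u wlow + c1 - c0"
    and p: "p > 0" and r: "r > 0"
    and gap: "\<And>w. wlow \<le> w \<Longrightarrow> u w - u ws + (if w \<le> a then r else 0) \<le> p * (w - ws)"
  shows "ws + min (u a - u wlow) r / p * bayes n \<le> (\<integral>x. w x \<partial>draws n M1)"
proof -
  interpret D0: prob_space "draws n M0" by (rule prob_space_draws)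
  interpret D1: prob_space "draws n M1" by (rule prob_space_draws)
  note [measurable_cong] = sets_draws[of n]
  have sp: "space (draws n M1) = space (draws n M0)" by (rule sets_eq_imp_space_eq[OF sets_draws])
  have w: "w \<in> borel_measurable (draws n M1)" "integrable (draws n M1) w"
     "integrable (draws n M1) (\<lambda>x. u (w x))" "integrable (draws n M0) (\<lambda>x. u (w x))"
     "(\<integral>x. u (w x) \<partial>draws n M1) - c1 \<ge> (\<integral>x. u (w x) \<partial>draws n M0) - c0"
    and wlow: "\<And>x. x \<in> space (draws n M0) \<Longrightarrow> wlow \<le> w x"
    using feas by (auto simp: feasible_contract_def sp)
  have [measurable]: "w \<in> borel_measurable (draws n M0)" using w(1) by simp
  define B where "B = {x \<in> space (draws n M0). w x > a}"
  define K where "K = min (u a - u wlow) r"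
  have B [measurable]: "B \<in> sets (draws n M0)" unfolding B_def by measurable
  have Bc [measurable]: "space (draws n M1) - B \<in> sets (draws n M1)" by measurable
  have "(u a - u wlow) * measure (draws n M0) B = (\<integral>x. (u a - u wlow) * indicator B x \<partial>draws n M0)"
    by (simp add: Int_absorb2 sets.sets_into_space)
  also have "\<dots> \<le> (\<integral>x. u (w x) - u wlow \<partial>draws n M0)"
  proof (intro integral_mono)
    fix x assume "x \<in> space (draws n M0)"
    then show "(u a - u wlow) * indicator B x \<le> u (w x) - u wlow"
      using mono[of a "w x"] mono[of wlow "w x"] wlow a by (auto simp: B_def indicator_def)
  qed (use w in \<open>auto simp: less_top[symmetric]\<close>)
  also have "\<dots> = (\<integral>x. u (w x) \<partial>draws n M0) - u wlow"
    using w by (simp add: D0.prob_space)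
  finally have e0: "(u a - u wlow) * measure (draws n M0) B \<le> (\<integral>x. u (w x) \<partial>draws n M0) - u wlow" .
  have "(\<integral>x. u (w x) \<partial>draws n M1) - u ws + r * measure (draws n M1) (space (draws n M1) - B)
      = (\<integral>x. u (w x) - u ws + r * indicator (space (draws n M1) - B) x \<partial>draws n M1)"
    using w by (simp add: D1.prob_space less_top[symmetric])
  also have "\<dots> \<le> (\<integral>x. p * (w x - ws) \<partial>draws n M1)"
  proof (intro integral_mono)
    fix x assume "x \<in> space (draws n M1)"
    then show "u (w x) - u ws + r * indicator (space (draws n M1) - B) x \<le> p * (w x - ws)"
      using gap[OF wlow, of x] by (auto simp: sp B_def indicator_def not_le)
  qed (use w in \<open>auto simp: less_top[symmetric]\<close>)
  also have "\<dots> = p * ((\<integral>x. w x \<partial>draws n M1) - ws)"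
    using w by (simp add: D1.prob_space)
  finally have e1: "(\<integral>x. u (w x) \<partial>draws n M1) - u ws + r * measure (draws n M1) (space (draws n M1) - B)
      \<le> p * ((\<integral>x. w x \<partial>draws n M1) - ws)" .
  have "K * bayes n \<le> K * (measure (draws n M0) B + measure (draws n M1) (space (draws n M1) - B))"
    using r mono[of wlow a] a by (intro mult_left_mono bayes_le_error_sum B) (auto simp: K_def)
  also have "\<dots> \<le> (u a - u wlow) * measure (draws n M0) B + r * measure (draws n M1) (space (draws n M1) - B)"
    unfolding distrib_left by (intro add_mono mult_right_mono) (auto simp: K_def)
  \<comment> \<open>By (IC) and the choice of \<open>ws\<close>, expected utility exceeds
    \<open>u ws\<close> under \<open>M1\<close> by at least as much as it exceeds
    \<open>u wlow\<close> under \<open>M0\<close>; this links \<open>e0\<close> to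
    \<open>e1\<close>.\<close>
  also have "\<dots> \<le> p * ((\<integral>x. w x \<partial>draws n M1) - ws)"
    using e0 e1 w(5) ws by linarith
  finally have "K * bayes n / p \<le> (\<integral>x. w x \<partial>draws n M1) - ws"
    using p by (simp add: divide_simps mult.commute)
  then show ?thesis by (simp add: K_def)
qed

text \<open>Incentives equal the utility spread times one minus the error sum. A raise
  \<open>t\<close> above \<open>ws\<close> whose utility is proportional to the error bound
  therefore makes up for the errors of the test.\<close>

lemma lr_test_contract:
  assumes mono: "\<And>v w. wlow \<le> v \<Longrightarrow> v \<le> w \<Longrightarrow> u v \<le> u w"
    and ws: "u ws = u wlow + c1 - c0" "wlow < ws" and c: "c0 < c1" and lim_liab: "c0 \<le> u wlow"
    and l: "0 \<le> l" "l \<le> 1" and small: "mgf l ^ n \<le> 1 / 2"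
    and t: "t \<ge> 0" and ut: "u ws + 2 * (c1 - c0) * mgf l ^ n \<le> u (ws + t)"
  obtains w where "feasible_contract M0 M1 n u wlow c0 c1 w" "card (w ` space (draws n M1)) = 2"
    "(\<integral>x. w x \<partial>draws n M1) \<le> ws + t"
proof -
  interpret D0: prob_space "draws n M0" by (rule prob_space_draws)
  interpret D1: prob_space "draws n M1" by (rule prob_space_draws)
  note [measurable_cong] = sets_draws[of n]
  have sp: "space (draws n M1) = space (draws n M0)" by (rule sets_eq_imp_space_eq[OF sets_draws])
  define B where "B = {x \<in> space (draws n M0). llr n x \<ge> 0}"
  have B [measurable]: "B \<in> sets (draws n M0)" unfolding B_def by measurable
  have B1 [measurable]: "B \<in> sets (draws n M1)" by (simp add: sets_draws)
  define w where "w = (\<lambda>x. if x \<in> B then ws + t else wlow)"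
  define \<epsilon> where "\<epsilon> = mgf l ^ n"
  define \<alpha> where "\<alpha> = 1 - measure (draws n M1) B"
  define \<beta> where "\<beta> = measure (draws n M0) B"
  have comp: "measure (draws n M1) (space (draws n M1) - B) = \<alpha>"
    by (simp add: \<alpha>_def D1.prob_compl)
  have err: "\<alpha> + \<beta> \<le> \<epsilon>"
    using error_sum_lr_test[OF l, of n] comp by (simp add: B_def \<beta>_def \<epsilon>_def)
  have \<alpha>0: "\<alpha> \<ge> 0" and \<beta>0: "\<beta> \<ge> 0" by (auto simp: \<alpha>_def \<beta>_def)
  have \<epsilon>: "0 \<le> \<epsilon>" "\<epsilon> \<le> 1/2" using err \<alpha>0 \<beta>0 small by (auto simp: \<epsilon>_def)
  \<comment> \<open>A generic \<open>f\<close> serves both utility and, as the identity, the wage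
    itself.\<close>
  have f_eq: "f (w x) = f wlow + (f (ws + t) - f wlow) * indicator B x" for f :: "real \<Rightarrow> real" and x
    by (simp add: w_def indicator_def)
  have int1: "integrable (draws n M1) (\<lambda>x. f (w x))"
    "(\<integral>x. f (w x) \<partial>draws n M1) = f wlow + (f (ws + t) - f wlow) * (1 - \<alpha>)" for f :: "real \<Rightarrow> real"
    unfolding f_eq[of f] by (auto simp: less_top[symmetric] D1.prob_space \<alpha>_def Int_absorb2 sets.sets_into_space[OF B1])
  have int0: "integrable (draws n M0) (\<lambda>x. f (w x))"
    "(\<integral>x. f (w x) \<partial>draws n M0) = f wlow + (f (ws + t) - f wlow) * \<beta>" for f :: "real \<Rightarrow> real"
    unfolding f_eq[of f] by (auto simp: less_top[symmetric] D0.prob_space \<beta>_def Int_absorb2 sets.sets_into_space[OF B])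
  define k where "k = c1 - c0"
  have k: "k > 0" using c by (simp add: k_def)
  \<comment> \<open>This is where the factor 2 in \<open>ut\<close> and the bound 1/2 in
    \<open>small\<close> come from: the loss \<open>2 * \<epsilon>\<^sup>2\<close> must not exceed
    the gain \<open>\<epsilon>\<close>.\<close>
  have "k \<le> k * (1 + \<epsilon> * (1 - 2 * \<epsilon>))" using k \<epsilon> by simp
  also have "\<dots> = (k + 2 * k * \<epsilon>) * (1 - \<epsilon>)" by (simp add: algebra_simps)
  also have "\<dots> \<le> (u (ws + t) - u wlow) * (1 - \<epsilon>)"
    using ut ws(1) \<epsilon> by (intro mult_right_mono) (auto simp: k_def \<epsilon>_def)
  also have "\<dots> \<le> (u (ws + t) - u wlow) * (1 - \<alpha> - \<beta>)"
    using mono[of wlow "ws + t"] ws t err by (intro mult_left_mono) auto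
  also have "\<dots> = (\<integral>x. u (w x) \<partial>draws n M1) - (\<integral>x. u (w x) \<partial>draws n M0)"
    unfolding int1(2)[of u] int0(2)[of u] by (simp add: algebra_simps)
  finally have IC: "(\<integral>x. u (w x) \<partial>draws n M1) - c1 \<ge> (\<integral>x. u (w x) \<partial>draws n M0) - c0"
    by (simp add: k_def)
  \<comment> \<open>Limited liability guarantees at least \<open>u wlow - c0 \<ge> 0\<close> after
    deviating, so (IC) implies (IR).\<close>
  have "(\<integral>x. u (w x) \<partial>draws n M0) \<ge> u wlow"
    unfolding int0(2)[of u] using mono[of wlow "ws + t"] ws t \<beta>0 by simp
  then have IR: "(\<integral>x. u (w x) \<partial>draws n M1) - c1 \<ge> 0" using IC lim_liab by linarith
  have "feasible_contract M0 M1 n u wlow c0 c1 w"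
    unfolding feasible_contract_def
    using IC IR int0(1)[of u] int1(1)[of u] int1(1)[of "\<lambda>x. x"] ws t by (auto simp: w_def)
  moreover have "card (w ` space (draws n M1)) = 2"
  proof -
    \<comment> \<open>A trivial test has error sum 1, beyond the bound 1/2; hence both wages really
      occur.\<close>
    have "B \<noteq> {}" using err \<epsilon> \<beta>0 by (auto simp: \<alpha>_def)
    moreover have "B \<noteq> space (draws n M0)" using err \<epsilon> \<alpha>0 by (auto simp: \<beta>_def D0.prob_space)
    moreover have "B \<subseteq> space (draws n M0)" by (auto simp: B_def)
    ultimately have "w ` space (draws n M1) = {ws + t, wlow}" unfolding sp w_def by auto
    then show ?thesis using ws t by simp
  qed
  moreover have "(\<integral>x. w x \<partial>draws n M1) \<le> ws + t"
  proof -
    have "(\<integral>x. w x \<partial>draws n M1) = wlow + (ws + t - wlow) * (1 - \<alpha>)" by (rule int1(2))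
    also have "\<dots> \<le> wlow + (ws + t - wlow) * 1"
      using ws t \<alpha>0 by (intro add_left_mono mult_left_mono) auto
    finally show ?thesis by simp
  qed
  ultimately show ?thesis using that by blast
qed

end

section \<open>Passing to the exponential rate\<close>

text \<open>After taking \<open>ln\<close> and dividing by \<open>n\<close>, the constants vanish
  and the factor \<open>exp (- d * n)\<close> costs only \<open>d\<close>, which is
  arbitrary.\<close>

lemma tendsto_log_rate:
  fixes a :: "nat \<Rightarrow> real"
  assumes m: "m > 0" and C: "C > 0" and D: "D > 0"
    and lower: "\<And>d::real. d > 0 \<Longrightarrow> eventually (\<lambda>n. C * (exp (- d * n) * m ^ n) \<le> a n) sequentially"
    and upper: "eventually (\<lambda>n. a n \<le> D * m ^ n) sequentially"
  shows "(\<lambda>n. ln (a n) / n) \<longlonglongrightarrow> ln m"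
proof (rule order_tendstoI)
  have const: "(\<lambda>n. ln c / real n) \<longlonglongrightarrow> 0" for c :: real
    by (rule tendsto_divide_0[OF tendsto_const]) (rule filterlim_real_at_infinity_sequentially)
  fix y
  {
    assume "y < ln m"
    define d where "d = (ln m - y) / 2"
    have d: "d > 0" using \<open>y < ln m\<close> by (simp add: d_def)
    have "eventually (\<lambda>n. ln C / real n > - d) sequentially"
      using order_tendstoD(1)[OF const, of "-d" C] d by simp
    with lower[OF d] eventually_gt_at_top[of 0]
    show "eventually (\<lambda>n. y < ln (a n) / n) sequentially"
    proof eventually_elim
      case (elim n)
      have "ln (C * (exp (- d * n) * m ^ n)) \<le> ln (a n)"
        using elim m C by (intro ln_mono) (auto intro: less_le_trans[rotated])
      then have "ln C - d * n + n * ln m \<le> ln (a n)"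
        using m C by (simp add: ln_mult ln_realpow)
      then have "(ln C - d * n + n * ln m) / n \<le> ln (a n) / n" by (rule divide_right_mono) simp
      then have "ln C / n - d + ln m \<le> ln (a n) / n"
        using elim(2) by (simp add: add_divide_distrib diff_divide_distrib)
      then show ?case using elim(3) by (simp add: d_def field_simps)
    qed
  }
  {
    assume "ln m < y"
    define d where "d = y - ln m"
    have d: "d > 0" using \<open>ln m < y\<close> by (simp add: d_def)
    have "eventually (\<lambda>n. ln D / real n < d) sequentially"
      using order_tendstoD(2)[OF const, of d D] d by simp
    with lower[OF zero_less_one] upper eventually_gt_at_top[of 0]
    show "eventually (\<lambda>n. ln (a n) / n < y) sequentially"
    proof eventually_elim
      case (elim n)
      \<comment> \<open>The lower bound with \<open>d = 1\<close> makes \<open>a n\<close> positive,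
        as monotonicity of \<open>ln\<close> requires.\<close>
      have "0 < C * (exp (- 1 * real n) * m ^ n)" using m C by simp
      also have "\<dots> \<le> a n" by fact
      finally have "ln (a n) \<le> ln (D * m ^ n)" using elim(2) by (intro ln_mono) auto
      then have "ln (a n) \<le> ln D + n * ln m"
        using m D by (simp add: ln_mult ln_realpow)
      then have "ln (a n) / n \<le> (ln D + n * ln m) / n" by (rule divide_right_mono) simp
      then have "ln (a n) / n \<le> ln D / n + ln m"
        using elim(3) by (simp add: add_divide_distrib)
      then show ?case using elim(4) by (simp add: d_def)
    qed
  }
qed

text \<open>\<open>Lim\<close> is a definite description and is informative only once convergence is
  known. A monotone \<open>u\<close> converges in the extended reals to its supremum, which cannot
  exceed an upper bound \<open>b\<close>.\<close>

lemma exists_gt_of_less_Lim: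
  fixes u :: "real \<Rightarrow> real"
  assumes mono: "\<And>v w. wlow \<le> v \<Longrightarrow> v \<le> w \<Longrightarrow> u v \<le> u w"
    and less: "ereal b < Lim at_top (\<lambda>w. ereal (u w))"
  obtains w where "wlow \<le> w" "b < u w"
proof (rule ccontr)
  assume no: "\<not> thesis"
  have le: "u w \<le> b" if "wlow \<le> w" for w
    using that no \<open>\<And>w. wlow \<le> w \<Longrightarrow> b < u w \<Longrightarrow> thesis\<close> by force
  define s where "s = (SUP w\<in>{wlow..}. ereal (u w))"
  have "((\<lambda>w. ereal (u w)) \<longlongrightarrow> s) at_top"
  proof (rule order_tendstoI)
    fix y assume "y < s"
    then obtain v where v: "wlow \<le> v" "y < ereal (u v)" by (auto simp: s_def less_SUP_iff)
    show "eventually (\<lambda>w. y < ereal (u w)) at_top"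
      using eventually_ge_at_top[of v]
      by eventually_elim (use v mono in \<open>force intro: less_le_trans\<close>)
  next
    fix y assume y: "s < y"
    show "eventually (\<lambda>w. ereal (u w) < y) at_top"
      using eventually_ge_at_top[of wlow]
    proof eventually_elim
      case (elim w)
      then have "ereal (u w) \<le> s" unfolding s_def by (intro SUP_upper) auto
      with y show ?case by simp
    qed
  qed
  then have "Lim at_top (\<lambda>w. ereal (u w)) = s" by (intro tendsto_Lim) auto
  moreover have "s \<le> ereal b" unfolding s_def by (rule SUP_least) (use le in auto)
  ultimately show False using less by simp
qed

theorem theorem2:
  fixes X :: "'a::euclidean_space set"
    and M0 M1 :: "'a measure"
    and u :: "real \<Rightarrow> real" and wlow c0 c1 :: real
  assumes P0: "prob_space M0" and P1: "prob_space M1"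
    and S0: "sets M0 = sets (restrict_space borel X)"
    and S1: "sets M1 = sets (restrict_space borel X)"
    and neq: "M0 \<noteq> M1"
    and ac01: "absolutely_continuous M0 M1" and ac10: "absolutely_continuous M1 M0"
    and mom01: "\<And>l::real. l > 0 \<Longrightarrow>
                 integrable M0 (\<lambda>x. enn2real (RN_deriv M0 M1 x) powr l)"
    and mom10: "\<And>l::real. l > 0 \<Longrightarrow>
                 integrable M1 (\<lambda>x. enn2real (RN_deriv M1 M0 x) powr l)"
    and u_C2: "\<exists>u' u''. (\<forall>w\<ge>wlow. (u has_real_derivative u' w) (at w within {wlow..}) \<and>
                                 (u' has_real_derivative u'' w) (at w within {wlow..}) \<and>
                                 u' w > 0 \<and> u'' w < 0)
                       \<and> continuous_on {wlow..} u'' \<and> (u' \<longlongrightarrow> 0) at_top"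
    and c_lt: "c0 < c1"
    and sev1: "u wlow \<ge> c0"
    and sev2: "ereal (u wlow + c1 - c0) < Lim at_top (\<lambda>w. ereal (u w))"
  shows "eventually (\<lambda>n. C_SB M0 M1 n u wlow c0 c1 > C_FB u wlow c0 c1) sequentially
       \<and> ((\<lambda>n. ereal (ln (C_SB M0 M1 n u wlow c0 c1 - C_FB u wlow c0 c1) / real n))
            \<longlonglongrightarrow> - Chernoff M0 M1)
       \<and> eventually (\<lambda>n. C_bin M0 M1 n u wlow c0 c1 > C_FB u wlow c0 c1) sequentially
       \<and> ((\<lambda>n. ereal (ln (C_bin M0 M1 n u wlow c0 c1 - C_FB u wlow c0 c1) / real n))
            \<longlonglongrightarrow> - Chernoff M0 M1)"
proof -
  interpret log_likelihood_ratio M0 M1 "\<lambda>x. ln (enn2real (RN_deriv M0 M1 x))"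
    using P0 P1 S0 S1 ac01 ac10 mom01 mom10 by (intro log_likelihood_ratioI) auto
  obtain l where l: "0 < l" "l < 1" and mgf_l: "mgf l < 1"
    and deriv0: "(\<integral>x. ln (enn2real (RN_deriv M0 M1 x)) * exp (l * ln (enn2real (RN_deriv M0 M1 x))) \<partial>M0) = 0"
    by (rule mgf_min_exists[OF neq])
  have Ch: "Chernoff M0 M1 = ereal (- ln (mgf l))"
    using Chernoff_le[OF deriv0] Chernoff_ge[of l] l by (intro antisym) auto
  obtain u' u'' where u: "\<And>w. wlow \<le> w \<Longrightarrow> (u has_real_derivative u' w) (at w within {wlow..})"
      "\<And>w. wlow \<le> w \<Longrightarrow> (u' has_real_derivative u'' w) (at w within {wlow..})"
      "\<And>w. wlow \<le> w \<Longrightarrow> u' w > 0" "\<And>w. wlow \<le> w \<Longrightarrow> u'' w < 0"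
    using u_C2 by blast
  have strict: "u v < u w" if "wlow \<le> v" "v < w" for v w
    using mvt_atLeast[OF u(1) that] u(3) that by (smt (verit) mult_pos_pos)
  have mono: "u v \<le> u w" if "wlow \<le> v" "v \<le> w" for v w
    using strict[of v w] that by (cases "v = w") auto
  have decr: "u' w < u' v" if "wlow \<le> v" "v < w" for v w
    using mvt_atLeast[OF u(2) that] u(4) that by (smt (verit) mult_neg_pos)
  have cont: "continuous_on {wlow..} u"
    using u(1) by (intro DERIV_continuous_on[where D=u']) auto
  obtain W where W: "wlow \<le> W" "u wlow + c1 - c0 < u W"
    by (rule exists_gt_of_less_Lim[OF mono sev2])
  obtain ws where ws: "wlow \<le> ws" "u ws = u wlow + c1 - c0"
    using IVT'[of u wlow "u wlow + c1 - c0" W] W c_lt continuous_on_subset[OF cont, of "{wlow..W}"]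
    by auto
  have ws_gt: "wlow < ws" using ws c_lt by (cases "ws = wlow") auto
  have inj: "inj_on u {wlow..}"
    by (rule linorder_inj_onI) (use strict in force)+
  have FB: "C_FB u wlow c0 c1 = ws"
    unfolding C_FB_def using ws inj by (intro the_inv_into_f_eq) auto
  define a where "a = (wlow + ws) / 2"
  have a: "wlow < a" "a < ws" using ws_gt by (auto simp: a_def)
  obtain r where r: "r > 0"
    and gap: "\<And>w. wlow \<le> w \<Longrightarrow> u w - u ws + (if w \<le> a then r else 0) \<le> u' ws * (w - ws)"
    using tangent_gap[OF u(1) decr less_imp_le[OF a(1)] a(2)] by blast
  \<comment> \<open>The division by 2 absorbs the factor lost in
    \<open>bayes_lower_bound\<close>.\<close>
  define C where "C = min (u a - u wlow) r / u' ws / 2"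
  have C: "C > 0" using r strict[of wlow a] a u(3)[of ws] ws by (simp add: C_def)
  \<comment> \<open>Marginal utility decreases, so its value at \<open>ws + 1\<close> bounds all
    slopes on the unit interval to the right of \<open>ws\<close>.\<close>
  define e where "e = u' (ws + 1)"
  have e: "e > 0" using u(3) ws by (simp add: e_def)
  have slope: "u ws + e * t \<le> u (ws + t)" if t: "0 \<le> t" "t \<le> 1" for t
  proof (cases "t = 0")
    case False
    then obtain \<xi> where "ws < \<xi>" "\<xi> < ws + t" "u (ws + t) - u ws = u' \<xi> * (ws + t - ws)"
      using mvt_atLeast[OF u(1) ws(1), of "ws + t"] t by auto
    moreover have "e \<le> u' \<xi>" unfolding e_def
      using decr[of \<xi> "ws + 1"] calculation ws t by (cases "\<xi> = ws + 1") auto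
    ultimately have "e * t \<le> u' \<xi> * t" "u (ws + t) - u ws = u' \<xi> * t"
      using t by (auto intro: mult_right_mono)
    then show ?thesis by simp
  qed simp
  \<comment> \<open>By \<open>slope\<close>, a raise of \<open>D * mgf l ^ n\<close> yields exactly
    the utility that \<open>lr_test_contract\<close> asks for.\<close>
  define D where "D = 2 * (c1 - c0) / e"
  have D: "D > 0" using e c_lt by (simp add: D_def)
  define SB where "SB = (\<lambda>n. {w. feasible_contract M0 M1 n u wlow c0 c1 w})"
  define Bin where "Bin = (\<lambda>n. {w. feasible_contract M0 M1 n u wlow c0 c1 w \<and> card (w ` space (draws n M1)) = 2})"
  define cost where "cost = (\<lambda>n (w :: _ \<Rightarrow> real). \<integral>x. w x \<partial>draws n M1)"
  have cost_ge: "ws + 2 * C * bayes n \<le> cost n w" if "w \<in> SB n" for n w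
    using contract_cost_ge[OF _ mono less_imp_le[OF a(1)] ws(2) u(3)[OF ws(1)] r gap] that
    by (simp add: SB_def cost_def C_def)
  have Bin_SB: "Bin n \<subseteq> SB n" for n by (auto simp: Bin_def SB_def)
  have bdd: "bdd_below (cost n ` SB n)" for n using cost_ge[of _ n] by (intro bdd_belowI2) auto
  have pow0: "(\<lambda>n. mgf l ^ n) \<longlonglongrightarrow> 0"
    using mgf_l mgf_pos[of l] by (intro LIMSEQ_realpow_zero) auto
  have ex: "eventually (\<lambda>n. \<exists>w\<in>Bin n. cost n w \<le> ws + D * mgf l ^ n) sequentially"
  proof -
    \<comment> \<open>The bound 1/2 is the one on the error sum; \<open>1 / D\<close> keeps the
      raise below 1, where \<open>slope\<close> applies.\<close>
    have "eventually (\<lambda>n. mgf l ^ n < min (1/2) (1 / D)) sequentially"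
      using order_tendstoD(2)[OF pow0, of "min (1/2) (1 / D)"] D by auto
    then show ?thesis
    proof eventually_elim
      case (elim n)
      have t: "0 \<le> D * mgf l ^ n" "D * mgf l ^ n \<le> 1"
        using elim D mgf_pos[of l] by (auto simp: field_simps)
      have ut: "u ws + 2 * (c1 - c0) * mgf l ^ n \<le> u (ws + D * mgf l ^ n)"
        using slope[OF t] e by (simp add: D_def)
      obtain w where "feasible_contract M0 M1 n u wlow c0 c1 w" "card (w ` space (draws n M1)) = 2"
          "(\<integral>x. w x \<partial>draws n M1) \<le> ws + D * mgf l ^ n"
        by (rule lr_test_contract[where u=u, OF mono ws(2) ws_gt c_lt sev1 _ _ _ t(1) ut]) (use l elim in auto)
      then show ?case by (auto simp: Bin_def cost_def)
    qed
  qed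
  \<comment> \<open>Both contract classes are treated at once: for any class between them, the lower
    bound comes from \<open>SB\<close> and the upper bound from \<open>Bin\<close>.\<close>
  have main: "eventually (\<lambda>n. Inf (cost n ` S n) > ws) sequentially \<and>
      ((\<lambda>n. ereal (ln (Inf (cost n ` S n) - ws) / real n)) \<longlonglongrightarrow> - Chernoff M0 M1)"
    if S: "\<And>n. S n \<subseteq> SB n" "\<And>n. Bin n \<subseteq> S n" for S
  proof
    have upper: "eventually (\<lambda>n. Inf (cost n ` S n) - ws \<le> D * mgf l ^ n) sequentially"
      using ex
    proof eventually_elim
      case (elim n)
      then obtain w where w: "w \<in> S n" "cost n w \<le> ws + D * mgf l ^ n" using S by blast
      have "Inf (cost n ` S n) \<le> cost n w"
        using w bdd_below_mono[OF bdd image_mono[OF S(1)]] by (intro cInf_lower) auto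
      then show ?case using w by simp
    qed
    have lower: "eventually (\<lambda>n. C * (exp (- d * n) * mgf l ^ n) \<le> Inf (cost n ` S n) - ws) sequentially"
      if d: "d > 0" for d :: real
      using ex bayes_lower_bound[OF less_imp_le[OF l(1)] less_imp_le[OF l(2)] deriv0 d]
    proof eventually_elim
      case (elim n)
      have "C * (exp (- d * n) * mgf l ^ n) = 2 * C * (exp (- d * n) * mgf l ^ n / 2)" by simp
      also have "\<dots> \<le> 2 * C * bayes n" using elim C by (intro mult_left_mono) auto
      also have "ws + 2 * C * bayes n \<le> Inf (cost n ` S n)"
      proof (rule cInf_greatest)
        show "cost n ` S n \<noteq> {}" using elim(1) S(2)[of n] by blast
        fix y assume "y \<in> cost n ` S n"
        then show "ws + 2 * C * bayes n \<le> y" using S(1)[of n] cost_ge by blast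
      qed
      finally show ?case by simp
    qed
    show "eventually (\<lambda>n. Inf (cost n ` S n) > ws) sequentially"
      using lower[OF zero_less_one]
    proof eventually_elim
      case (elim n)
      have "0 < C * (exp (- 1 * real n) * mgf l ^ n)" using C mgf_pos[of l] by simp
      with elim show ?case by simp
    qed
    have "(\<lambda>n. ln (Inf (cost n ` S n) - ws) / n) \<longlonglongrightarrow> ln (mgf l)"
      by (rule tendsto_log_rate[OF mgf_pos C D lower upper])
    then show "(\<lambda>n. ereal (ln (Inf (cost n ` S n) - ws) / real n)) \<longlonglongrightarrow> - Chernoff M0 M1"
      by (simp add: Ch)
  qed
  show ?thesis
    using main[of SB] main[of Bin] Bin_SB
    unfolding FB C_SB_def C_bin_def SB_def Bin_def cost_def by blast
qed

end
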